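(* Let $f:\mathbb{R}^{n_x}\times\mathbb{R}^{n_y}\to\mathbb{R}$, $g:\mathbb{R}^{n_x}\times\mathbb{R}^{n_y}\to\mathbb{R}^{n_y}$ and $\Omega\subseteq\mathbb{R}^{n_x}\times\mathbb{R}^{n_y}$. Assume that $\Omega$ and $\Gamma=\{(x,y) : (x,y)\in\Omega,\ y\ge 0,\ g(x,y)\ge 0\}$ are non-empty and compact. Let $$f^{pen}(x,y)=\sum_{i=1}^{n_y}\frac{y_i+g_i(x,y)}{2}.$$ Let $(x^0,y^0)\in\Gamma$ be lexicographically minimal with respect to $(f^{pen},f)$. Moreover, let $(x^0,y^0)$ be properly efficient for the bicriteria problem of minimizing $f$ and $f^{pen}$ over $\Gamma$, with the trade-off bounded by a scalar $\bar L>0$. Then for every $L>\bar L$, $(x^0,y^0)$ is an optimal solution of the $L$-penalty problem $$\min\ f(x,y)+L\sum_{i=1}^{n_y}\frac{y_i+g_i(x,y)}{2}\quad\text{s.t. } (x,y)\in\Omega,\ y\ge 0,\ g(x,y)\ge 0.$$ Moreover, if $(x^0,y^0)$ satisfies complementarity, then for every $L>\bar L$ the $L$-penalty problem has an optimal solution that satisfies complementarity.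
   Context: Here $x\in\mathbb{R}^{n_x}$ and $y\in\mathbb{R}^{n_y}$; vector inequalities are componentwise. A point $(x,y)\in\Gamma$ satisfies complementarity if $y^{\top}g(x,y)=0$ (equivalently, on $\Gamma$, for each $i$ at least one of $y_i$, $g_i(x,y)$ is zero). Lexicographic minimality: $(x^0,y^0)\in\Gamma$ is lexicographically minimal with respect to $(f^{pen},f)$ if, for an optimal solution $(\bar x,\bar y)$ of $\min_{(x,y)\in\Gamma} f^{pen}(x,y)$, the point $(x^0,y^0)$ is an optimal solution of $\min\{f(x,y) : f^{pen}(x,y)=f^{pen}(\bar x,\bar y),\ (x,y)\in\Gamma\}$. Efficiency: $(\bar x,\bar y)\in\Gamma$ is efficient for the bicriteria problem of minimizing $f$ and $f^{pen}$ over $\Gamma$ if there is no $(x,y)\in\Gamma$ with $f(x,y)\le f(\bar x,\bar y)$ and $f^{pen}(x,y)\le f^{pen}(\bar x,\bar y)$ with at least one of these inequalities strict. Proper efficiency (Geoffrion): $(\bar x,\bar y)\in\Gamma$ is properly efficient, with the trade-off bounded by the scalar $\bar L>0$, if it is efficient and (i) for all $(x,y)\in\Gamma$ with $f(x,y)<f(\bar x,\bar y)$ and $f^{pen}(x,y)>f^{pen}(\bar x,\bar y)$, $$\frac{f(\bar x,\bar y)-f(x,y)}{f^{pen}(x,y)-f^{pen}(\bar x,\bar y)}\le\bar L;$$ (ii) for all $(x,y)\in\Gamma$ with $f^{pen}(x,y)<f^{pen}(\bar x,\bar y)$ and $f(x,y)>f(\bar x,\bar y)$, $$\frac{f^{pen}(\bar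 x,\bar y)-f^{pen}(x,y)}{f(x,y)-f(\bar x,\bar y)}\le\bar L.$$ *)

theory Defs
  imports "HOL-Analysis.Analysis"
begin

abbreviation optimal_solution :: "('a \<Rightarrow> real) \<Rightarrow> 'a set \<Rightarrow> 'a \<Rightarrow> bool" where
  "optimal_solution h S z \<equiv> is_arg_min h (\<lambda>w. w \<in> S) z"

text \<open>
  The order on \<open>real ^ 'm\<close> is the componentwise one.
\<close>

definition feasible_set ::
  "((real ^ 'n) \<times> (real ^ 'm)) set \<Rightarrow> ((real ^ 'n) \<times> (real ^ 'm) \<Rightarrow> real ^ 'm) \<Rightarrow> ((real ^ 'n) \<times> (real ^ 'm)) set"
  where "feasible_set \<Omega> g = {(x, y). (x, y) \<in> \<Omega> \<and> y \<ge> 0 \<and> g (x, y) \<ge> 0}"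

definition f_pen ::
  "((real ^ 'n) \<times> (real ^ 'm) \<Rightarrow> real ^ 'm) \<Rightarrow> (real ^ 'n) \<times> (real ^ 'm) \<Rightarrow> real"
  where "f_pen g = (\<lambda>(x, y). \<Sum>i\<in>UNIV. (y $ i + g (x, y) $ i) / 2)"

definition complementarity ::
  "((real ^ 'n) \<times> (real ^ 'm) \<Rightarrow> real ^ 'm) \<Rightarrow> (real ^ 'n) \<times> (real ^ 'm) \<Rightarrow> bool"
  where "complementarity g = (\<lambda>(x, y). y \<bullet> g (x, y) = 0)"

text \<open>
  Lexicographic minimality with respect to \<open>(p, h)\<close>: the first objective \<open>p\<close> has priority.
  The choice of the minimizer \<open>zbar\<close> is immaterial, since only the minimal value \<open>p zbar\<close>
  is used; a minimizer of \<open>p\<close> is required to exist.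
\<close>

definition lex_minimal :: "('a \<Rightarrow> real) \<Rightarrow> ('a \<Rightarrow> real) \<Rightarrow> 'a set \<Rightarrow> 'a \<Rightarrow> bool" where
  "lex_minimal p h S z0 \<longleftrightarrow> z0 \<in> S \<and>
     (\<exists>zbar. optimal_solution p S zbar \<and>
             optimal_solution h {z. p z = p zbar \<and> z \<in> S} z0)"

definition efficient :: "('a \<Rightarrow> real) \<Rightarrow> ('a \<Rightarrow> real) \<Rightarrow> 'a set \<Rightarrow> 'a \<Rightarrow> bool" where
  "efficient h p S zbar \<longleftrightarrow> zbar \<in> S \<and>
     \<not> (\<exists>z\<in>S. h z \<le> h zbar \<and> p z \<le> p zbar \<and> (h z < h zbar \<or> p z < p zbar))"

text \<open>Geoffrion's proper efficiency, with the trade-off bound \<open>Lbar\<close> as a parameter.\<close>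

definition properly_efficient ::
  "('a \<Rightarrow> real) \<Rightarrow> ('a \<Rightarrow> real) \<Rightarrow> 'a set \<Rightarrow> real \<Rightarrow> 'a \<Rightarrow> bool" where
  "properly_efficient h p S Lbar zbar \<longleftrightarrow>
     efficient h p S zbar \<and>
     (\<forall>z\<in>S. h z < h zbar \<and> p z > p zbar \<longrightarrow> (h zbar - h z) / (p z - p zbar) \<le> Lbar) \<and>
     (\<forall>z\<in>S. p z < p zbar \<and> h z > h zbar \<longrightarrow> (p zbar - p z) / (h z - h zbar) \<le> Lbar)"

end

theory Submission
  imports Defs
begin

text \<open>
  Lexicographic minimality makes \<open>(x0, y0)\<close> a minimizer of the penalty term over the feasible
  set, so a feasible point can have a smaller penalized objective only by having a smaller
  \<open>f\<close>. Efficiency forces such a point to pay with a strictly larger penalty term, and the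
  bound on the trade-off says that a gain in \<open>f\<close> is at most \<open>Lbar\<close> times the increase of the
  penalty term. With a weight \<open>L > Lbar\<close> this increase costs more than the gain
  (\<open>weighted_sum_optimal_if_properly_efficient\<close>). Hence \<open>(x0, y0)\<close> itself is optimal for every
  such \<open>L\<close>, and it is the required complementary solution whenever it is complementary.
\<close>

lemma lex_minimal_imp_minimizes_first:
  assumes "lex_minimal p h S z0" and "z \<in> S"
  shows "p z0 \<le> p z"
  using assms unfolding lex_minimal_def is_arg_min_linorder by force

text \<open>
  In the \<open>(p, h)\<close>-plane, the line of slope \<open>- L\<close> through the image of \<open>z0\<close> supports the image of
  \<open>S\<close>: no image point lies to the left of that of \<open>z0\<close>, and the lower ones are joined to it by
  a segment that falls no more steeply than \<open>Lbar\<close>.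
\<close>

lemma weighted_sum_optimal_if_properly_efficient:
  assumes peff: "properly_efficient h p S Lbar z0"
    and pmin: "\<And>z. z \<in> S \<Longrightarrow> p z0 \<le> p z"
    and "Lbar \<le> L" and "0 \<le> L"
  shows "optimal_solution (\<lambda>z. h z + L * p z) S z0"
  unfolding is_arg_min_linorder
proof (intro conjI allI impI)
  show "z0 \<in> S"
    using peff by (simp add: properly_efficient_def efficient_def)
next
  fix z assume z: "z \<in> S"
  show "h z0 + L * p z0 \<le> h z + L * p z"
  proof (cases "h z < h z0")
    case True
    \<comment> \<open>otherwise \<open>z\<close> would dominate \<open>z0\<close>\<close>
    have gap: "p z0 < p z"
      using peff z True pmin[OF z] unfolding properly_efficient_def efficient_def
      by force
    have "(h z0 - h z) / (p z - p z0) \<le> Lbar"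
      using peff z True gap unfolding properly_efficient_def by blast
    then have "h z0 - h z \<le> Lbar * (p z - p z0)"
      using gap by (simp add: pos_divide_le_eq)
    also have "\<dots> \<le> L * (p z - p z0)"
      using \<open>Lbar \<le> L\<close> gap by (intro mult_right_mono) simp_all
    finally show ?thesis
      by (simp add: algebra_simps)
  next
    case False
    then show ?thesis
      using pmin[OF z] \<open>0 \<le> L\<close> by (intro add_mono mult_left_mono) simp_all
  qed
qed

theorem theorem4:
  fixes f :: "(real ^ 'n) \<times> (real ^ 'm) \<Rightarrow> real"
    and g :: "(real ^ 'n) \<times> (real ^ 'm) \<Rightarrow> real ^ 'm"
    and \<Omega> :: "((real ^ 'n) \<times> (real ^ 'm)) set"
    and x0 :: "real ^ 'n" and y0 :: "real ^ 'm"
    and Lbar :: real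
  assumes "\<Omega> \<noteq> {}" and "compact \<Omega>"
    and "feasible_set \<Omega> g \<noteq> {}" and "compact (feasible_set \<Omega> g)"
    and "(x0, y0) \<in> feasible_set \<Omega> g"
    and "lex_minimal (f_pen g) f (feasible_set \<Omega> g) (x0, y0)"
    and "Lbar > 0"
    and "properly_efficient f (f_pen g) (feasible_set \<Omega> g) Lbar (x0, y0)"
  shows "(\<forall>L>Lbar. optimal_solution
            (\<lambda>(x, y). f (x, y) + L * (\<Sum>i\<in>UNIV. (y $ i + g (x, y) $ i) / 2))
            {(x, y). (x, y) \<in> \<Omega> \<and> y \<ge> 0 \<and> g (x, y) \<ge> 0} (x0, y0)) \<and>
         (complementarity g (x0, y0) \<longrightarrow>
           (\<forall>L>Lbar. \<exists>x y. optimal_solution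
              (\<lambda>(x, y). f (x, y) + L * (\<Sum>i\<in>UNIV. (y $ i + g (x, y) $ i) / 2))
              {(x, y). (x, y) \<in> \<Omega> \<and> y \<ge> 0 \<and> g (x, y) \<ge> 0} (x, y) \<and>
            complementarity g (x, y)))"
proof -
  let ?pen_obj = "\<lambda>L (x, y). f (x, y) + L * (\<Sum>i\<in>UNIV. (y $ i + g (x, y) $ i) / 2)"
  let ?S = "{(x, y). (x, y) \<in> \<Omega> \<and> y \<ge> 0 \<and> g (x, y) \<ge> 0}"
  have opt: "optimal_solution (?pen_obj L) ?S (x0, y0)" if "L > Lbar" for L
  proof -
    have "optimal_solution (\<lambda>z. f z + L * f_pen g z) (feasible_set \<Omega> g) (x0, y0)"
      using that \<open>Lbar > 0\<close>
        lex_minimal_imp_minimizes_first[OF assms(6)]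
      by (intro weighted_sum_optimal_if_properly_efficient[OF assms(8)]) simp_all
    moreover have "(\<lambda>z. f z + L * f_pen g z) = ?pen_obj L"
      by (auto simp: f_pen_def)
    ultimately show ?thesis
      by (simp add: feasible_set_def)
  qed
  then show ?thesis
    by blast
qed

end
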